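(* Let $\mathbb{K}$ be an algebraically closed field of arbitrary characteristic, and let $\det_4$ be the determinant of a generic $4\times 4$ matrix, a quartic form in $16$ variables over $\mathbb{K}$. Then $\mathbf{pr}(\det_4)\geq 7$.
   Context: The product rank $\mathbf{pr}(f)$ of a degree $d$ form $f$ is the smallest number $r$ such that $f=\boldsymbol{\ell}_1+\dots+\boldsymbol{\ell}_r$ where each $\boldsymbol{\ell}_i$ is a product of $d$ linear forms. A generic matrix has independent variables as its entries. *)

theory Defs
  imports
    "HOL-Analysis.Analysis"
    "HOL-Library.Poly_Mapping"
    "HOL-Computational_Algebra.Polynomial"
begin

text \<open>
  Polynomials in the variables \<open>'v\<close> with coefficients in \<open>'k\<close>: finitely supported maps from
  monomials (finitely supported exponent vectors) to coefficients, multiplied by convolution.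
\<close>
type_synonym ('v, 'k) mpoly = "('v \<Rightarrow>\<^sub>0 nat) \<Rightarrow>\<^sub>0 'k"

definition Var :: "'v \<Rightarrow> ('v, 'k::comm_ring_1) mpoly" where
  "Var v = Poly_Mapping.single (Poly_Mapping.single v 1) 1"

definition monom_degree :: "('v \<Rightarrow>\<^sub>0 nat) \<Rightarrow> nat" where
  "monom_degree m = (\<Sum>v\<in>Poly_Mapping.keys m. Poly_Mapping.lookup m v)"

text \<open>As usual, the zero polynomial counts as a form of every degree.\<close>
definition is_form :: "nat \<Rightarrow> ('v, 'k::comm_ring_1) mpoly \<Rightarrow> bool" where
  "is_form d f \<longleftrightarrow> (\<forall>m\<in>Poly_Mapping.keys f. monom_degree m = d)"

abbreviation linear_form :: "('v, 'k::comm_ring_1) mpoly \<Rightarrow> bool" where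
  "linear_form \<equiv> is_form 1"

definition has_product_decomposition ::
    "nat \<Rightarrow> ('v, 'k::comm_ring_1) mpoly \<Rightarrow> nat \<Rightarrow> bool" where
  "has_product_decomposition d f r \<longleftrightarrow>
    (\<exists>l :: nat \<Rightarrow> nat \<Rightarrow> ('v, 'k) mpoly.
      (\<forall>i<r. \<forall>j<d. linear_form (l i j)) \<and> f = (\<Sum>i<r. \<Prod>j<d. l i j))"

text \<open>
  Meant for a form \<open>f\<close> of degree \<open>d \<ge> 1\<close>; a decomposition then exists, since every term
  \<open>c \<cdot> x\<^sub>1 \<cdots> x\<^sub>d\<close> of \<open>f\<close> is itself a product of \<open>d\<close> linear forms. The degree is a parameter
  because it is not determined by \<open>f\<close> when \<open>f = 0\<close>.
\<close>
definition product_rank :: "nat \<Rightarrow> ('v, 'k::comm_ring_1) mpoly \<Rightarrow> nat" where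
  "product_rank d f = (LEAST r. has_product_decomposition d f r)"

definition generic_matrix :: "('n::finite \<times> 'n, 'k::comm_ring_1) mpoly ^ 'n ^ 'n" where
  "generic_matrix = (\<chi> i j. Var (i, j))"

definition det4 :: "(4 \<times> 4, 'k::comm_ring_1) mpoly" where
  "det4 = det (generic_matrix :: (4 \<times> 4, 'k) mpoly ^ 4 ^ 4)"

end

(*
  The second order partial derivatives of det_4 are the 36 two by two minors up to sign, which are
  linearly independent, while those of a product l_0 l_1 l_2 l_3 of linear forms lie in the span of
  the six products l_c l_d. If det_4 were a sum of at most six products, the minors would therefore
  span the same space as the at most 36 quadrics l_c l_d, so each l_c l_d would vanish on all rank
  one matrices. As rank one matrices form an irreducible variety spanning the whole space, l_c or
  l_d would be zero, hence all these quadrics would be zero, which is absurd. The minors are never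
  computed: mixed partials are coefficients of s t after perturbing two entries by s and t, which
  makes sense in every characteristic.
*)

theory Submission
  imports Defs "HOL-Library.Function_Algebras"
begin

section \<open>Evaluating polynomials over an extension of the coefficient ring\<close>

lemma monomial_value_add:
  fixes x :: "'v \<Rightarrow> 'r::comm_semiring_1"
  shows "(\<Prod>v\<in>Poly_Mapping.keys (m + n). x v ^ Poly_Mapping.lookup (m + n) v) =
    (\<Prod>v\<in>Poly_Mapping.keys m. x v ^ Poly_Mapping.lookup m v) *
    (\<Prod>v\<in>Poly_Mapping.keys n. x v ^ Poly_Mapping.lookup n v)"
proof -
  let ?A = "Poly_Mapping.keys m \<union> Poly_Mapping.keys n"
  have ext: "(\<Prod>v\<in>Poly_Mapping.keys k. x v ^ Poly_Mapping.lookup k v) =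
      (\<Prod>v\<in>?A. x v ^ Poly_Mapping.lookup k v)" if "Poly_Mapping.keys k \<subseteq> ?A" for k
    by (rule prod.mono_neutral_left) (use that in \<open>auto simp: in_keys_iff\<close>)
  have "(\<Prod>v\<in>Poly_Mapping.keys (m + n). x v ^ Poly_Mapping.lookup (m + n) v) =
      (\<Prod>v\<in>?A. x v ^ Poly_Mapping.lookup m v * x v ^ Poly_Mapping.lookup n v)"
    unfolding ext[OF keys_add] by (simp add: lookup_add power_add)
  then show ?thesis
    by (simp add: ext[of m] ext[of n] prod.distrib)
qed

lemma poly_mapping_expansion:
  "f = (\<Sum>m\<in>Poly_Mapping.keys f. Poly_Mapping.single m (Poly_Mapping.lookup f m))"
  by (rule poly_mapping_eqI)
    (simp add: lookup_sum lookup_single when_def not_in_keys_iff_lookup_eq_zero)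

text \<open>Points of evaluation may have coordinates in a ring other than that of the coefficients;
  \<open>h\<close> carries the coefficients there. The case of interest is the embedding of
  \<open>'k\<close> into \<open>'k poly poly\<close>.\<close>

locale comm_ring_1_hom =
  fixes h :: "'k::comm_ring_1 \<Rightarrow> 'r::comm_ring_1"
  assumes hom_add: "h (a + b) = h a + h b"
    and hom_mult: "h (a * b) = h a * h b"
    and hom_one: "h 1 = 1"
begin

lemma hom_zero: "h 0 = 0"
  using hom_add[of 0 0] by simp

definition eval :: "('v \<Rightarrow> 'r) \<Rightarrow> ('v, 'k) mpoly \<Rightarrow> 'r" where
  "eval x f = (\<Sum>m\<in>Poly_Mapping.keys f. h (Poly_Mapping.lookup f m) *
     (\<Prod>v\<in>Poly_Mapping.keys m. x v ^ Poly_Mapping.lookup m v))"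

lemma eval_zero: "eval x 0 = 0"
  by (simp add: eval_def)

lemma eval_add: "eval x (f + g) = eval x f + eval x g"
  unfolding eval_def
  by (rule setsum_keys_plus_distrib) (simp_all add: hom_zero hom_add distrib_right)

lemma eval_single:
  "eval x (Poly_Mapping.single m c) =
     h c * (\<Prod>v\<in>Poly_Mapping.keys m. x v ^ Poly_Mapping.lookup m v)"
  by (simp add: eval_def hom_zero)

lemma eval_one: "eval x 1 = 1"
  by (simp add: eval_def hom_one)

lemma eval_sum: "eval x (\<Sum>i\<in>A. f i) = (\<Sum>i\<in>A. eval x (f i))"
  by (induction A rule: infinite_finite_induct) (simp_all add: eval_zero eval_add)

lemma eval_uminus: "eval x (- f) = - eval x f"
  using eval_add[of x f "- f"] by (simp add: eval_zero eq_neg_iff_add_eq_0 add.commute)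

lemma eval_mult: "eval x (f * g) = eval x f * eval x g"
proof -
  have "f * g = (\<Sum>m\<in>Poly_Mapping.keys f. \<Sum>n\<in>Poly_Mapping.keys g.
      Poly_Mapping.single (m + n) (Poly_Mapping.lookup f m * Poly_Mapping.lookup g n))"
    by (subst poly_mapping_expansion[of f], subst poly_mapping_expansion[of g])
      (simp add: sum_product mult_single)
  then show ?thesis
    by (simp add: eval_sum eval_single hom_mult monomial_value_add)
      (simp add: eval_def sum_product mult_ac)
qed

lemma eval_prod: "eval x (\<Prod>i\<in>A. f i) = (\<Prod>i\<in>A. eval x (f i))"
  by (induction A rule: infinite_finite_induct) (simp_all add: eval_one eval_mult)

lemma eval_sign: "eval x (of_int (sign p)) = of_int (sign p)"
  by (cases p rule: sign_cases) (simp_all add: eval_one eval_uminus)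

lemma eval_det: "eval x (det A) = det (\<chi> i j. eval x (A $ i $ j))"
  by (simp add: det_def eval_sum eval_mult eval_prod eval_sign)

lemma eval_Var: "eval x (Var v) = x v"
  by (simp add: Var_def eval_single hom_one)

end

section \<open>Linear forms as functions\<close>

lemma monom_degree_eq_1:
  assumes "monom_degree m = 1"
  obtains v where "m = Poly_Mapping.single v 1"
proof -
  have "(\<Sum>v\<in>Poly_Mapping.keys m. Poly_Mapping.lookup m v) = 1"
    using assms by (simp add: monom_degree_def)
  then obtain v where v: "v \<in> Poly_Mapping.keys m" "Poly_Mapping.lookup m v = 1"
    and rest: "\<forall>w\<in>Poly_Mapping.keys m. w \<noteq> v \<longrightarrow> Poly_Mapping.lookup m w = 0"
    using sum_eq_1_iff[of "Poly_Mapping.keys m" "Poly_Mapping.lookup m"] by auto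
  have "m = Poly_Mapping.single v 1"
    using v rest by (intro poly_mapping_eqI) (auto simp: lookup_single when_def in_keys_iff)
  then show thesis by (rule that)
qed

definition linear_coeff :: "('v, 'k::comm_ring_1) mpoly \<Rightarrow> 'v \<Rightarrow> 'k" where
  "linear_coeff l v = Poly_Mapping.lookup l (Poly_Mapping.single v 1)"

definition linear_fun :: "('v::finite, 'k::comm_ring_1) mpoly \<Rightarrow> ('v \<Rightarrow> 'k) \<Rightarrow> 'k" where
  "linear_fun l x = (\<Sum>v\<in>UNIV. linear_coeff l v * x v)"

text \<open>The monomials of degree one are the \<open>Poly_Mapping.single v 1\<close>, so the sum
  over monomials can be reindexed by variables.\<close>

lemma (in comm_ring_1_hom) eval_linear_form:
  fixes x :: "'v::finite \<Rightarrow> 'r"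
  assumes "linear_form l"
  shows "eval x l = (\<Sum>v\<in>UNIV. h (linear_coeff l v) * x v)"
proof -
  let ?s = "\<lambda>v. Poly_Mapping.single v (1::nat)"
  have inj: "inj ?s"
    by (rule injI) (metis lookup_single_eq lookup_single_not_eq zero_neq_one)
  have sub: "Poly_Mapping.keys l \<subseteq> range ?s"
    using assms unfolding is_form_def by (metis monom_degree_eq_1 rangeI subsetI)
  have "eval x l = (\<Sum>m\<in>range ?s. h (Poly_Mapping.lookup l m) *
      (\<Prod>v\<in>Poly_Mapping.keys m. x v ^ Poly_Mapping.lookup m v))"
    unfolding eval_def
    by (rule sum.mono_neutral_left) (use sub in \<open>auto simp: in_keys_iff hom_zero\<close>)
  also have "\<dots> = (\<Sum>v\<in>UNIV. h (linear_coeff l v) * x v)"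
    by (subst sum.reindex[OF inj]) (simp add: linear_coeff_def)
  finally show ?thesis .
qed

section \<open>Mixed partials by perturbation with two independent parameters\<close>

interpretation const_hom: comm_ring_1_hom "\<lambda>c::'k::comm_ring_1. [:[:c:]:]"
  by unfold_locales (simp_all add: one_pCons)

text \<open>The outer polynomial variable perturbs \<open>a\<close>, the inner one perturbs \<open>b\<close>.\<close>

definition mixed_partial :: "'v \<Rightarrow> 'v \<Rightarrow> ('v, 'k::comm_ring_1) mpoly \<Rightarrow> ('v \<Rightarrow> 'k) \<Rightarrow> 'k" where
  "mixed_partial a b f x = coeff (coeff (const_hom.eval
     (\<lambda>v. [:[:x v:]:] + (if v = a then [:0, 1:] else 0) + (if v = b then [:[:0, 1:]:] else 0)) f) 1) 1"

lemma sum_const_poly2: "(\<Sum>v\<in>A. [:[:f v:]:]) = [:[:\<Sum>v\<in>A. f v:]:]"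
  by (induction A rule: infinite_finite_induct) auto

lemma eval_linear_form_perturbed:
  fixes x :: "'v::finite \<Rightarrow> 'k::comm_ring_1"
  assumes "linear_form l"
  shows "const_hom.eval
     (\<lambda>v. [:[:x v:]:] + (if v = a then [:0, 1:] else 0) + (if v = b then [:[:0, 1:]:] else 0)) l
   = [:[:linear_fun l x, linear_coeff l b:], [:linear_coeff l a:]:]"
proof -
  have "[:[:c:]:] * ([:[:x v:]:] + (if v = a then [:0, 1:] else 0) + (if v = b then [:[:0, 1:]:] else 0))
    = [:[:c * x v:]:] + (if v = a then [:0, [:c:]:] else 0) + (if v = b then [:[:0, c:]:] else 0)" for c v
    by (simp add: distrib_left)
  then show ?thesis
    by (simp only: const_hom.eval_linear_form[OF assms] sum.distrib sum_const_poly2)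
      (simp add: linear_fun_def)
qed

text \<open>One factor supplies the outer variable, a second one the inner variable, and the other
  two their values. The terms are grouped by the pair that supplies values.\<close>

lemma coeff_mixed_prod4:
  fixes p q r :: "nat \<Rightarrow> 'k::comm_ring_1"
  shows "coeff (coeff (\<Prod>j<4. [:[:p j, q j:], [:r j:]:]) 1) 1 =
    (r 2 * q 3 + r 3 * q 2) * (p 0 * p 1) + (r 1 * q 3 + r 3 * q 1) * (p 0 * p 2) +
    (r 1 * q 2 + r 2 * q 1) * (p 0 * p 3) + (r 0 * q 3 + r 3 * q 0) * (p 1 * p 2) +
    (r 0 * q 2 + r 2 * q 0) * (p 1 * p 3) + (r 0 * q 1 + r 1 * q 0) * (p 2 * p 3)"
  by (simp add: eval_nat_numeral algebra_simps)


section \<open>Mixed partials of determinants at special matrices\<close>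

lemma mixed_partial_det:
  "mixed_partial (i1, j1) (i2, j2) (det generic_matrix) x = coeff (coeff (det (\<chi> i j.
     [:[:x (i, j):]:] + (if (i, j) = (i1, j1) then [:0, 1:] else 0) +
     (if (i, j) = (i2, j2) then [:[:0, 1:]:] else 0))) 1) 1"
  by (simp only: mixed_partial_def const_hom.eval_det generic_matrix_def const_hom.eval_Var vec_lambda_beta)

lemma det_zero_row_comm_ring:
  fixes A :: "'a::comm_ring_1^'n^'n"
  assumes "\<And>j. A $ i $ j = 0"
  shows "det A = 0"
proof -
  have "A = (\<chi> k. if k = i then 0 else A $ k)"
    using assms by (auto simp: vec_eq_iff)
  then show ?thesis
    using det_row_0[of i "\<lambda>k. A $ k"] by simp
qed

lemma det_zero_column_comm_ring:
  fixes A :: "'a::comm_ring_1^'n^'n"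
  assumes "\<And>i. A $ i $ j = 0"
  shows "det A = 0"
  using det_zero_row_comm_ring[of "transpose A" j] assms det_transpose[of A] by (simp add: transpose_def)

text \<open>Every permutation other than \<open>p\<close> meets a zero entry, so a single Leibniz
  term survives.\<close>

lemma det_permutation_support:
  fixes d :: "'n::finite \<Rightarrow> 'a::comm_ring_1"
  assumes p: "p permutes UNIV"
  shows "det (\<chi> i j. if j = p i then d i else 0) = of_int (sign p) * (\<Prod>i\<in>UNIV. d i)"
proof -
  have "(\<Prod>i\<in>UNIV. if q i = p i then d i else 0) = 0" if "q \<noteq> p" for q
    using that by (intro prod_zero) auto
  then have "det (\<chi> i j. if j = p i then d i else 0) =
      (\<Sum>q | q permutes UNIV. if q = p then of_int (sign p) * (\<Prod>i\<in>UNIV. d i) else 0)"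
    unfolding det_def by (intro sum.cong) auto
  then show ?thesis
    using p by (simp add: finite_permutations)
qed

text \<open>Neither perturbation touches row \<open>i\<close>, so the perturbed matrix still has a
  zero row.\<close>

lemma mixed_partial_det_zero_row:
  assumes "i \<noteq> i1" "i \<noteq> i2" "\<And>j. x (i, j) = 0"
  shows "mixed_partial (i1, j1) (i2, j2) (det generic_matrix) x = 0"
  unfolding mixed_partial_det
  by (subst det_zero_row_comm_ring[where i = i]) (use assms in auto)

lemma mixed_partial_det_zero_column:
  assumes "j \<noteq> j1" "j \<noteq> j2" "\<And>i. x (i, j) = 0"
  shows "mixed_partial (i1, j1) (i2, j2) (det generic_matrix) x = 0"
  unfolding mixed_partial_det
  by (subst det_zero_column_comm_ring[where j = j]) (use assms in auto)

text \<open>The point is the matrix of \<open>p\<close> with rows \<open>i1\<close> and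
  \<open>i2\<close> erased. The two perturbations fill exactly these gaps, so the determinant is the
  product of both variables up to sign.\<close>

lemma mixed_partial_det_permutation:
  assumes p: "p permutes UNIV" and ne: "i1 \<noteq> i2"
  shows "mixed_partial (i1, p i1) (i2, p i2) (det generic_matrix)
    (\<lambda>(i, j). if i \<noteq> i1 \<and> i \<noteq> i2 \<and> j = p i then 1 else 0 :: 'k::comm_ring_1) = of_int (sign p)"
proof -
  let ?d = "\<lambda>i. if i = i1 then [:0, 1:] else if i = i2 then [:[:0, 1:]:] else 1 :: 'k poly poly"
  have "(\<chi> i j. [:[:(\<lambda>(i, j). if i \<noteq> i1 \<and> i \<noteq> i2 \<and> j = p i then 1 else 0 :: 'k) (i, j):]:] +
       (if (i, j) = (i1, p i1) then [:0, 1:] else 0) +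
       (if (i, j) = (i2, p i2) then [:[:0, 1:]:] else 0)) = (\<chi> i j. if j = p i then ?d i else 0)"
    using ne by (auto simp: vec_eq_iff one_pCons)
  moreover have "(\<Prod>i\<in>UNIV. ?d i) = [:0, [:0, 1:]:]"
  proof -
    have U: "UNIV = insert i1 (insert i2 (UNIV - {i1, i2}))"
      by auto
    have "(\<Prod>i\<in>UNIV - {i1, i2}. ?d i) = 1"
      by (rule prod.neutral) auto
    then show ?thesis
      using ne by (subst U) simp
  qed
  ultimately show ?thesis
    by (cases p rule: sign_cases) (simp_all add: mixed_partial_det det_permutation_support[OF p])
qed

section \<open>Rank one matrices\<close>

text \<open>Such a matrix factors through a free module of rank three; padding the factors to square
  matrices leaves a zero column in the left one.\<close>

lemma det4_sum_of_three_rank_one: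
  fixes A :: "'a::comm_ring_1^4^4"
  assumes "\<And>i j. A $ i $ j = u1 i * v1 j + u2 i * v2 j + u3 i * v3 j"
  shows "det A = 0"
proof -
  let ?U = "(\<chi> i k. if k = 1 then u1 i else if k = 2 then u2 i else if k = 3 then u3 i else 0) :: 'a^4^4"
  let ?V = "(\<chi> k j. if k = 1 then v1 j else if k = 2 then v2 j else if k = 3 then v3 j else 0) :: 'a^4^4"
  have "A = ?U ** ?V"
    using assms by (simp add: vec_eq_iff matrix_matrix_mult_def sum_4)
  moreover have "det ?U = 0"
    by (rule det_zero_column_comm_ring[where j = 4]) simp
  ultimately show ?thesis
    by (simp add: det_mul)
qed

text \<open>Perturbing a rank one matrix in two entries gives rank at most three.\<close>

lemma mixed_partial_det4_rank_one:
  fixes x y :: "4 \<Rightarrow> 'k::comm_ring_1"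
  shows "mixed_partial (i1, j1) (i2, j2) det4 (\<lambda>(i, j). x i * y j) = 0"
proof -
  have "det ((\<chi> i j. [:[:(\<lambda>(i, j). x i * y j) (i, j):]:] +
      (if (i, j) = (i1, j1) then [:0, 1:] else 0) +
      (if (i, j) = (i2, j2) then [:[:0, 1:]:] else 0)) :: 'k poly poly^4^4) = 0"
    by (rule det4_sum_of_three_rank_one[where
        ?u1.0 = "\<lambda>i. [:[:x i:]:]" and ?v1.0 = "\<lambda>j. [:[:y j:]:]" and
        ?u2.0 = "\<lambda>i. if i = i1 then [:0, 1:] else 0" and ?v2.0 = "\<lambda>j. if j = j1 then 1 else 0" and
        ?u3.0 = "\<lambda>i. if i = i2 then [:[:0, 1:]:] else 0" and ?v3.0 = "\<lambda>j. if j = j2 then 1 else 0"])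
      auto
  then show ?thesis
    by (simp only: det4_def mixed_partial_det) simp
qed

text \<open>If \<open>f a\<close> and \<open>g b\<close> are both nonzero, then
  \<open>g a = 0\<close> and \<open>f b = 0\<close>, so neither map kills
  \<open>a + b\<close>.\<close>

lemma additive_union_kernels:
  fixes f g :: "'a::plus \<Rightarrow> 'b::comm_monoid_add"
  assumes "\<And>a b. f (a + b) = f a + f b" "\<And>a b. g (a + b) = g a + g b"
    and "\<And>a. f a = 0 \<or> g a = 0"
  shows "(\<forall>a. f a = 0) \<or> (\<forall>a. g a = 0)"
  using assms by (metis add.left_neutral add.right_neutral)

text \<open>The rank one matrices span, and they form an irreducible variety; for products of two linear
  forms this amounts to a vector space not being the union of two proper subspaces.\<close>

lemma linear_fun_mult_zero_on_rank_one:
  fixes l m :: "('i::finite \<times> 'j::finite, 'k::idom) mpoly"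
  assumes "\<And>x y. linear_fun l (\<lambda>(i, j). x i * y j) * linear_fun m (\<lambda>(i, j). x i * y j) = 0"
  shows "linear_fun l = 0 \<or> linear_fun m = 0"
proof -
  let ?B = "\<lambda>l x y. linear_fun l (\<lambda>(i, j). x i * y j)"
  have add2: "?B l x (y + z) = ?B l x y + ?B l x z" and add1: "?B l (x + w) y = ?B l x y + ?B l w y"
    for l :: "('i \<times> 'j, 'k) mpoly" and x w y z
    by (simp_all add: linear_fun_def algebra_simps split_beta flip: sum.distrib)
  \<comment> \<open>First pass: \<open>x\<close> is fixed and both forms are additive in
    \<open>y\<close>.\<close>
  have "(\<forall>y. ?B l x y = 0) \<or> (\<forall>y. ?B m x y = 0)" for x
    by (rule additive_union_kernels) (use assms[of x] add2 in auto)
  then have "?B l x = 0 \<or> ?B m x = 0" for x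
    by (auto simp: fun_eq_iff)
  moreover have "?B l (x + w) = ?B l x + ?B l w" for l :: "('i \<times> 'j, 'k) mpoly" and x w
    by (rule ext) (simp only: plus_fun_apply[of "?B l x"] add1)
  \<comment> \<open>Second pass: the additive maps now send \<open>x\<close> to a whole function of
    \<open>y\<close>.\<close>
  ultimately have "(\<forall>x. ?B l x = 0) \<or> (\<forall>x. ?B m x = 0)"
    by (intro additive_union_kernels)
  moreover have "linear_fun l = 0" if "\<forall>x. ?B l x = 0" for l :: "('i \<times> 'j, 'k) mpoly"
  proof -
    have "linear_coeff l v = 0" for v
    proof -
      obtain a b where v: "v = (a, b)"
        by fastforce
      \<comment> \<open>Matrix units have rank one, and evaluating there reads off the
        coefficients.\<close>
      have "(\<lambda>(i, j). (if i = a then 1 else 0) * (if j = b then 1 else 0)) = (\<lambda>v. if v = (a, b) then 1 else 0 :: 'k)"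
        by auto
      then have "linear_coeff l v = ?B l (\<lambda>i. if i = a then 1 else 0) (\<lambda>j. if j = b then 1 else 0)"
        by (simp add: v linear_fun_def if_distrib cong: if_cong)
      also have "\<dots> = 0"
        using fun_cong[OF that[rule_format]] by (simp only: zero_fun_apply)
      finally show ?thesis .
    qed
    then show ?thesis
      by (simp add: linear_fun_def fun_eq_iff)
  qed
  ultimately show ?thesis
    by blast
qed

section \<open>Spans and independence in spaces of functions\<close>

interpretation fun_space: vector_space "\<lambda>(c::'k::field) (f::'x \<Rightarrow> 'k) x. c * f x"
  by unfold_locales (auto simp: fun_eq_iff algebra_simps)

lemma span_vanishes:
  assumes "f \<in> fun_space.span S" "\<And>g. g \<in> S \<Longrightarrow> g x = 0"
  shows "f x = 0"
  using assms(1) by (induction rule: fun_space.span_induct_alt) (auto simp: assms(2))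

text \<open>At \<open>t a\<close> all members of the family except \<open>F a\<close> vanish, hence
  so does their span, which therefore misses \<open>F a\<close>.\<close>

lemma independent_of_dual_points:
  fixes F :: "'a \<Rightarrow> 'x \<Rightarrow> 'k::field"
  assumes "\<And>a. a \<in> A \<Longrightarrow> F a (t a) \<noteq> 0"
    and "\<And>a b. a \<in> A \<Longrightarrow> b \<in> A \<Longrightarrow> a \<noteq> b \<Longrightarrow> F a (t b) = 0"
  shows "inj_on F A" "fun_space.independent (F ` A)"
proof -
  show "inj_on F A"
    using assms by (metis inj_onI)
  show "fun_space.independent (F ` A)"
    unfolding fun_space.dependent_def
  proof safe
    fix a assume a: "a \<in> A" "F a \<in> fun_space.span (F ` A - {F a})"
    have "F a (t a) = 0"
      by (rule span_vanishes[OF a(2)]) (use assms(2) a(1) in auto)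
    with assms(1) a(1) show False
      by blast
  qed
qed

lemma sum_fun_apply: "(\<Sum>i\<in>A. f i) x = (\<Sum>i\<in>A. f i x)"
  by (induction A rule: infinite_finite_induct) simp_all

section \<open>Mixed partials of a sum of products\<close>

text \<open>The spanning set depends on neither \<open>a\<close> nor \<open>b\<close>: these enter
  only through scalar coefficients. Each summand contributes six quadrics.\<close>

lemma mixed_partial_product_sum_in_span:
  fixes l :: "nat \<Rightarrow> nat \<Rightarrow> ('v::finite, 'k::field) mpoly"
  assumes "\<And>i j. i < r \<Longrightarrow> j < 4 \<Longrightarrow> linear_form (l i j)"
  shows "mixed_partial a b (\<Sum>i<r. \<Prod>j<4. l i j) \<in> fun_space.span
    ((\<lambda>(i, c, d). linear_fun (l i c) * linear_fun (l i d)) `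
      ({..<r} \<times> {(0, 1), (0, 2), (0, 3), (1, 2), (1, 3), (2, 3)}))" (is "_ \<in> fun_space.span ?P")
proof -
  let ?q = "\<lambda>i c d. linear_coeff (l i c) a * linear_coeff (l i d) b +
    linear_coeff (l i d) a * linear_coeff (l i c) b"
  \<comment> \<open>The factors \<open>c\<close> and \<open>d\<close> are differentiated, and the
    complementary factors \<open>e\<close> and \<open>f\<close> remain.\<close>
  let ?s = "\<lambda>i (c, d) (e, f) x. ?q i c d * (linear_fun (l i e) * linear_fun (l i f)) x"
  let ?g = "\<lambda>i. ?s i (2, 3) (0, 1) + ?s i (1, 3) (0, 2) + ?s i (1, 2) (0, 3) +
    ?s i (0, 3) (1, 2) + ?s i (0, 2) (1, 3) + ?s i (0, 1) (2, 3)"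
  have "mixed_partial a b (\<Prod>j<4. l i j) x = ?g i x" if "i < r" for i x
  proof -
    have "mixed_partial a b (\<Prod>j<4. l i j) x = coeff (coeff (\<Prod>j<4.
        [:[:linear_fun (l i j) x, linear_coeff (l i j) b:], [:linear_coeff (l i j) a:]:]) 1) 1"
      unfolding mixed_partial_def const_hom.eval_prod
      by (subst prod.cong[OF refl eval_linear_form_perturbed[OF assms[OF that]]]) auto
    then show ?thesis
      unfolding coeff_mixed_prod4 by simp
  qed
  then have "mixed_partial a b (\<Sum>i<r. \<Prod>j<4. l i j) x = (\<Sum>i<r. ?g i x)" for x
    by (simp add: mixed_partial_def const_hom.eval_sum coeff_sum)
  then have sum_g: "mixed_partial a b (\<Sum>i<r. \<Prod>j<4. l i j) = (\<Sum>i<r. ?g i)"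
    by (simp add: fun_eq_iff sum_fun_apply)
  have g_span: "?g i \<in> fun_space.span ?P" if "i < r" for i
    unfolding split_conv
    by (intro fun_space.span_add fun_space.span_scale fun_space.span_base) (use that in force)+
  show ?thesis
    unfolding sum_g by (rule fun_space.span_sum, rule g_span) simp
qed

section \<open>The 36 minors and their dual points\<close>

text \<open>A bijection from \<open>I\<close> to \<open>J\<close> is glued to one between the
  complements.\<close>

lemma permutation_mapping_pairs:
  fixes I J :: "'n::finite set"
  assumes "card I = 2" "card J = 2"
  obtains p i1 i2 where "p permutes UNIV" "I = {i1, i2}" "i1 \<noteq> i2" "J = {p i1, p i2}"
proof -
  obtain f where f: "bij_betw f I J"
    using assms finite_same_card_bij[of I J] by auto
  obtain g where g: "bij_betw g (- I) (- J)"
    using assms finite_same_card_bij[of "- I" "- J"] by (auto simp: card_Diff_subset Compl_eq_Diff_UNIV)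
  let ?p = "\<lambda>i. if i \<in> I then f i else g i"
  have "bij_betw ?p (I \<union> - I) (J \<union> - J)"
    by (rule bij_betw_disjoint_Un[OF f g]) auto
  then have "?p permutes UNIV"
    by (intro bij_imp_permutes) auto
  moreover obtain i1 i2 where "I = {i1, i2}" "i1 \<noteq> i2"
    using assms(1) by (auto simp: card_2_iff)
  moreover have "J = ?p ` I"
    using f by (auto simp: bij_betw_def)
  ultimately show thesis
    using that[of ?p i1 i2] by auto
qed

text \<open>The index is a pair of two-element sets of rows and columns. Up to sign,
  \<open>F\<close> is the minor on the complementary rows and columns, and \<open>t\<close> is a
  permutation matrix placed in that block and zero elsewhere.\<close>

lemma det4_mixed_partials_family:
  obtains A :: "(4 set \<times> 4 set) set" and F :: "4 set \<times> 4 set \<Rightarrow> (4 \<times> 4 \<Rightarrow> 'k::field) \<Rightarrow> 'k" and t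
  where "card A = 36"
    and "\<And>a. a \<in> A \<Longrightarrow> \<exists>v w. F a = mixed_partial v w det4"
    and "\<And>a. a \<in> A \<Longrightarrow> F a (t a) \<noteq> 0"
    and "\<And>a b. a \<in> A \<Longrightarrow> b \<in> A \<Longrightarrow> a \<noteq> b \<Longrightarrow> F a (t b) = 0"
proof -
  let ?S = "{I :: 4 set. card I = 2}"
  let ?A = "?S \<times> ?S"
  have "card ?S = 6"
    using n_subsets[of "UNIV :: 4 set" 2] by (simp add: choose_two)
  then have card: "card ?A = 36"
    by (simp add: card_cartesian_product)
  have "\<forall>a\<in>?A. \<exists>p i1 i2. p permutes UNIV \<and> fst a = {i1, i2} \<and> i1 \<noteq> i2 \<and> snd a = {p i1, p i2}"
  proof
    fix a :: "4 set \<times> 4 set" assume "a \<in> ?A"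
    then have "card (fst a) = 2" "card (snd a) = 2"
      by auto
    then show "\<exists>p i1 i2. p permutes UNIV \<and> fst a = {i1, i2} \<and> i1 \<noteq> i2 \<and> snd a = {p i1, p i2}"
      by (rule permutation_mapping_pairs) blast
  qed
  from bchoice[OF this] obtain p where
    "\<forall>a\<in>?A. \<exists>i1 i2. p a permutes UNIV \<and> fst a = {i1, i2} \<and> i1 \<noteq> i2 \<and> snd a = {p a i1, p a i2}" ..
  from bchoice[OF this] obtain i1 where
    "\<forall>a\<in>?A. \<exists>i2. p a permutes UNIV \<and> fst a = {i1 a, i2} \<and> i1 a \<noteq> i2 \<and> snd a = {p a (i1 a), p a i2}" ..
  from bchoice[OF this] obtain i2 where p: "\<And>a. a \<in> ?A \<Longrightarrow> p a permutes UNIV"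
    and I: "\<And>a. a \<in> ?A \<Longrightarrow> fst a = {i1 a, i2 a}" and ne: "\<And>a. a \<in> ?A \<Longrightarrow> i1 a \<noteq> i2 a"
    and J: "\<And>a. a \<in> ?A \<Longrightarrow> snd a = {p a (i1 a), p a (i2 a)}"
    by blast
  let ?F = "\<lambda>a. mixed_partial (i1 a, p a (i1 a)) (i2 a, p a (i2 a)) det4 :: (4 \<times> 4 \<Rightarrow> 'k) \<Rightarrow> 'k"
  let ?t = "\<lambda>a (i, j). if i \<noteq> i1 a \<and> i \<noteq> i2 a \<and> j = p a i then 1 else 0 :: 'k"
  show thesis
  proof (rule that[of ?A ?F ?t])
    fix a assume "a \<in> ?A"
    then have "?F a (?t a) = of_int (sign (p a))"
      unfolding det4_def by (intro mixed_partial_det_permutation p ne)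
    then show "?F a (?t a) \<noteq> 0"
      by (cases "p a" rule: sign_cases) simp_all
  next
    fix a b assume ab: "a \<in> ?A" "b \<in> ?A" "a \<noteq> b"
    \<comment> \<open>Distinct sets of equal size are not contained in one another; this yields a
      zero row or column of \<open>?t b\<close> that the perturbations for \<open>a\<close>
      avoid.\<close>
    have diff: "\<exists>i. i \<in> K \<and> i \<notin> L" if "K \<in> ?S" "L \<in> ?S" "K \<noteq> L" for K L
      using that card_subset_eq[of L K] by auto
    have S: "fst a \<in> ?S" "snd a \<in> ?S" "fst b \<in> ?S" "snd b \<in> ?S"
      using ab by auto
    consider "fst b \<noteq> fst a" | "snd b \<noteq> snd a"
      using ab(3) by (auto simp: prod_eq_iff)
    then show "?F a (?t b) = 0"
    proof cases
      case 1
      then obtain i where "i \<in> fst b" "i \<notin> fst a"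
        using diff[OF S(3,1)] by blast
      then show ?thesis
        unfolding det4_def using I[OF ab(1)] I[OF ab(2)]
        by (intro mixed_partial_det_zero_row[where i = i]) auto
    next
      case 2
      then obtain j where j: "j \<in> snd b" "j \<notin> snd a"
        using diff[OF S(4,2)] by blast
      \<comment> \<open>Column \<open>j\<close> is already the image of \<open>i1 b\<close> or
        \<open>i2 b\<close>, so by injectivity it is zero in \<open>?t b\<close>.\<close>
      have "j \<noteq> p b i" if "i \<noteq> i1 b" "i \<noteq> i2 b" for i
        using that j(1) J[OF ab(2)] permutes_inj[OF p[OF ab(2)]] by (auto dest: injD)
      then show ?thesis
        unfolding det4_def using j(2) J[OF ab(1)]
        by (intro mixed_partial_det_zero_column[where j = j]) auto
    qed
  next
    show "\<exists>v w. ?F a = mixed_partial v w det4" for a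
      by blast
  qed (rule card)
qed

section \<open>The dimension count\<close>

lemma det4_product_decomposition_ge_7:
  assumes "has_product_decomposition 4 (det4 :: (4 \<times> 4, 'k::field) mpoly) r"
  shows "7 \<le> r"
proof (rule ccontr)
  assume "\<not> 7 \<le> r"
  obtain l :: "nat \<Rightarrow> nat \<Rightarrow> (4 \<times> 4, 'k) mpoly"
    where lin: "\<And>i j. i < r \<Longrightarrow> j < 4 \<Longrightarrow> linear_form (l i j)"
      and det: "det4 = (\<Sum>i<r. \<Prod>j<4. l i j)"
    using assms by (auto simp: has_product_decomposition_def)
  obtain A :: "(4 set \<times> 4 set) set" and F :: "4 set \<times> 4 set \<Rightarrow> (4 \<times> 4 \<Rightarrow> 'k) \<Rightarrow> 'k" and t
    where A: "card A = 36" and F: "\<And>a. a \<in> A \<Longrightarrow> \<exists>v w. F a = mixed_partial v w det4"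
      and diag: "\<And>a. a \<in> A \<Longrightarrow> F a (t a) \<noteq> 0"
      and off: "\<And>a b. a \<in> A \<Longrightarrow> b \<in> A \<Longrightarrow> a \<noteq> b \<Longrightarrow> F a (t b) = 0"
    by (rule det4_mixed_partials_family) blast
  note indep = independent_of_dual_points[of A F t, OF diag off]
  let ?D = "{(0, 1), (0, 2), (0, 3), (1, 2), (1, 3), (2, 3)} :: (nat \<times> nat) set"
  let ?P = "(\<lambda>(i, c, d). linear_fun (l i c) * linear_fun (l i d)) ` ({..<r} \<times> ?D)"
  have finP: "finite ?P"
    by simp
  have "card ?P \<le> card ({..<r} \<times> ?D)"
    by (rule card_image_le) simp
  also have "\<dots> \<le> 36"
    using \<open>\<not> 7 \<le> r\<close> by (simp add: card_cartesian_product)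
  finally have cardP: "card ?P \<le> 36" .
  have FP: "F ` A \<subseteq> fun_space.span ?P"
  proof
    fix f assume "f \<in> F ` A"
    then obtain v w where "f = mixed_partial v w det4"
      using F by blast
    then show "f \<in> fun_space.span ?P"
      using mixed_partial_product_sum_in_span[OF lin] by (simp only: det)
  qed
  have cardF: "card (F ` A) = 36"
    using card_image[OF indep(1)] A by simp
  have P_span: "?P \<subseteq> fun_space.span (F ` A)"
  proof (rule ccontr)
    assume "\<not> ?P \<subseteq> fun_space.span (F ` A)"
    then obtain g where g: "g \<in> ?P" "g \<notin> fun_space.span (F ` A)"
      by blast
    \<comment> \<open>Adjoining \<open>g\<close> would give 37 independent functions in the span of
      at most 36.\<close>
    have "card (insert g (F ` A)) \<le> card ?P"
      using fun_space.independent_span_bound[OF finP fun_space.independent_insertI[OF g(2) indep(2)]]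
        FP fun_space.span_base[OF g(1)] by simp
    moreover have "g \<notin> F ` A"
      using g(2) fun_space.span_base by blast
    moreover have "finite (F ` A)"
      using cardF by (intro card_ge_0_finite) simp
    ultimately show False
      using cardF cardP by simp
  qed
  have P_rank_one: "g (\<lambda>(i, j). x i * y j) = 0" if "g \<in> ?P" for g x y
  proof (rule span_vanishes[of g "F ` A"])
    show "g \<in> fun_space.span (F ` A)"
      using that P_span by blast
    show "f (\<lambda>(i, j). x i * y j) = 0" if f: "f \<in> F ` A" for f
    proof -
      obtain v w where "f = mixed_partial v w det4"
        using f F by blast
      then show ?thesis
        using mixed_partial_det4_rank_one by (cases v; cases w) simp
    qed
  qed
  have P_zero: "g = 0" if P: "g \<in> ?P" for g
  proof -
    obtain q where "g = (\<lambda>(i, c, d). linear_fun (l i c) * linear_fun (l i d)) q"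
      using P by (rule imageE)
    then obtain i c d where g: "g = linear_fun (l i c) * linear_fun (l i d)"
      by (cases q) simp
    have "linear_fun (l i c) = 0 \<or> linear_fun (l i d) = 0"
      by (rule linear_fun_mult_zero_on_rank_one)
        (use P_rank_one[OF P] in \<open>simp only: g times_fun_apply\<close>)
    then show ?thesis
      using g by auto
  qed
  \<comment> \<open>All spanning quadrics are zero, so every minor in their span is zero too,
    against \<open>diag\<close>.\<close>
  have "F a (t a) = 0" if "a \<in> A" for a
  proof (rule span_vanishes[of "F a" ?P])
    show "F a \<in> fun_space.span ?P"
      using FP that by blast
    show "g (t a) = 0" if "g \<in> ?P" for g
      by (simp only: P_zero[OF that] zero_fun_apply)
  qed
  then have "A = {}"
    using diag by blast
  with A show False
    by simp
qed

section \<open>Existence of a decomposition and the final bound\<close>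

lemma linear_form_Var: "linear_form (Var v)"
  by (simp add: is_form_def Var_def monom_degree_def)

text \<open>The Leibniz expansion is a decomposition. Some decomposition must exist for the
  \<open>LEAST\<close> in \<open>product_rank\<close> to be attained.\<close>

lemma has_product_decomposition_det:
  "\<exists>r. has_product_decomposition CARD('n::finite)
     (det (generic_matrix :: ('n \<times> 'n, 'k::comm_ring_1) mpoly ^ 'n ^ 'n)) r"
proof -
  let ?S = "{p. p permutes (UNIV :: 'n set)}"
  obtain q where q: "bij_betw q {..<card ?S} ?S"
    using ex_bij_betw_nat_finite[OF finite_permutations[OF finite]] by (auto simp: atLeast0LessThan)
  obtain e where e: "bij_betw e {..<CARD('n)} (UNIV :: 'n set)"
    using ex_bij_betw_nat_finite[OF finite, of "UNIV :: 'n set"] by (auto simp: atLeast0LessThan)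
  \<comment> \<open>The sign is absorbed into the factor with index 0; \<open>q\<close> enumerates
    the permutations and \<open>e\<close> the rows.\<close>
  define l :: "nat \<Rightarrow> nat \<Rightarrow> ('n \<times> 'n, 'k) mpoly" where
    "l = (\<lambda>i j. (if j = 0 then of_int (sign (q i)) else 1) * Var (e j, q i (e j)))"
  have "linear_form (l i j)" for i j
  proof -
    have "linear_form (Var (e j, q i (e j)) :: ('n \<times> 'n, 'k) mpoly)"
      by (rule linear_form_Var)
    then show ?thesis
      by (cases "q i" rule: sign_cases; cases "j = 0") (simp_all add: l_def is_form_def)
  qed
  moreover have "det generic_matrix = (\<Sum>i<card ?S. \<Prod>j<CARD('n). l i j)"
  proof -
    have "(\<Prod>j<CARD('n). l i j) = of_int (sign (q i)) * (\<Prod>k\<in>UNIV. Var (k, q i k))" for i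
    proof -
      have "(\<Prod>j<CARD('n). Var (e j, q i (e j))) = (\<Prod>k\<in>UNIV. Var (k, q i k) :: ('n \<times> 'n, 'k) mpoly)"
        by (rule prod.reindex_bij_betw[OF e])
      then show ?thesis
        by (simp add: l_def prod.distrib)
    qed
    moreover have "det (generic_matrix :: ('n \<times> 'n, 'k) mpoly ^ 'n ^ 'n) =
        (\<Sum>i<card ?S. of_int (sign (q i)) * (\<Prod>k\<in>UNIV. Var (k, q i k)))"
      unfolding det_def generic_matrix_def vec_lambda_beta
      by (rule sum.reindex_bij_betw[OF q, symmetric])
    ultimately show ?thesis
      by simp
  qed
  ultimately show ?thesis
    unfolding has_product_decomposition_def by blast
qed

theorem mainTheorem7:
  shows "product_rank 4 (det4 :: (4 \<times> 4, 'k::alg_closed_field) mpoly) \<ge> 7"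
proof -
  have "\<exists>r. has_product_decomposition 4 (det4 :: (4 \<times> 4, 'k) mpoly) r"
    using has_product_decomposition_det[where 'n = 4] by (simp add: det4_def)
  then have "has_product_decomposition 4 (det4 :: (4 \<times> 4, 'k) mpoly) (product_rank 4 (det4 :: (4 \<times> 4, 'k) mpoly))"
    unfolding product_rank_def by (rule LeastI_ex)
  then show ?thesis
    by (rule det4_product_decomposition_ge_7)
qed

end
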